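(* Let $(\mathcal{J}_1,\circ)$ be the $3$-dimensional Jordan algebra over $\mathbb{C}$ with basis $\{e_1,e_2,e_3\}$ and formal characteristic matrix $$\begin{pmatrix} 2e_1&2e_2&2e_3\\ 2e_2&0&2e_1\\ 2e_3&2e_1&0\end{pmatrix}.$$ Any compatible pre-Jordan algebra structure on $(\mathcal{J}_1,\circ)$ is isomorphic to one of the following (mutually non-isomorphic) pre-Jordan algebras given by their formal characteristic matrices: $$\mathcal{J}_{1,1}(\alpha):\begin{pmatrix} e_1 & e_1+(1+\lambda)e_2+\frac{e_3}{2\lambda} & 2\alpha e_1+2\lambda\alpha e_2+(2-\lambda)e_3\\ -e_1+(1-\lambda)e_2-\frac{e_3}{2\lambda} & 0 & 2\lambda e_1-2\alpha e_2+e_3\\ -2\alpha e_1-2\lambda\alpha e_2+\lambda e_3 & (2-2\lambda)e_1+2\alpha e_2-e_3 & 0\end{pmatrix},$$ where $\alpha\in\mathbb{C}$ and $\lambda$ is a nonzero root of $x^2-x+\alpha=0$, and different choices of $\lambda$ (for the same $\alpha$) give isomorphic pre-Jordan algebras; $$\mathcal{J}_{1,2}:\begin{pmatrix} e_1&2e_2&e_3\\ 0&0&2e_1\\ e_3&0&0\end{pmatrix},\qquad \mathcal{J}_{1,3}:\begin{pmatrix} e_1&2e_2&e_2+e_3\\ 0&0&2e_1\\ -e_2+e_3&0&0\end{pmatrix}.$$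
   Context: All vector spaces and algebras are over $\mathbb{C}$. A Jordan algebra is a vector space $J$ with a commutative bilinear multiplication $\circ$ satisfying $((x\circ x)\circ y)\circ x=(x\circ x)\circ(y\circ x)$ for all $x,y$. A pre-Jordan algebra is a vector space $A$ with a bilinear multiplication $\cdot$ such that, writing $x\circ y:=x\cdot y+y\cdot x$, for all $x,y,z,u\in A$: $$(x\circ y)\cdot(z\cdot u)+(y\circ z)\cdot(x\cdot u)+(z\circ x)\cdot(y\cdot u)= x\cdot(y\cdot(z\cdot u))+z\cdot(y\cdot(x\cdot u))+((x\circ z)\circ y)\cdot u= z\cdot((x\circ y)\cdot u)+x\cdot((y\circ z)\cdot u)+y\cdot((z\circ x)\cdot u).$$ A compatible pre-Jordan algebra structure on a Jordan algebra $(J,\circ)$ is a pre-Jordan multiplication $\cdot$ on the vector space $J$ with $x\cdot y+y\cdot x=x\circ y$ for all $x,y\in J$. An isomorphism of pre-Jordan algebras is a bijective linear map preserving the multiplications. The formal characteristic matrix of an algebra with basis $\{e_i\}$ is the matrix whose $(i,j)$ entry is the product of $e_i$ and $e_j$ (in that order); it determines the algebra. *)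

theory Defs
  imports "HOL-Analysis.Analysis"
begin

locale complex_algebra = vector_space scale
  for scale :: "complex \<Rightarrow> 'a::ab_group_add \<Rightarrow> 'a" +
  fixes mult :: "'a \<Rightarrow> 'a \<Rightarrow> 'a"
  assumes linear_right: "Vector_Spaces.linear scale scale (\<lambda>y. mult x y)"
    and linear_left: "Vector_Spaces.linear scale scale (\<lambda>x. mult x y)"

locale jordan_algebra = complex_algebra scale mult
  for scale :: "complex \<Rightarrow> 'a::ab_group_add \<Rightarrow> 'a" and mult :: "'a \<Rightarrow> 'a \<Rightarrow> 'a" +
  assumes commutative: "mult x y = mult y x"
    and jordan_identity: "mult (mult (mult x x) y) x = mult (mult x x) (mult y x)"

(* No factor 1/2. *)
definition anticomm :: "('a \<Rightarrow> 'a \<Rightarrow> 'a::ab_group_add) \<Rightarrow> 'a \<Rightarrow> 'a \<Rightarrow> 'a"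
  where "anticomm m x y = m x y + m y x"

locale pre_jordan_algebra = complex_algebra scale mult
  for scale :: "complex \<Rightarrow> 'a::ab_group_add \<Rightarrow> 'a" and mult :: "'a \<Rightarrow> 'a \<Rightarrow> 'a" +
  assumes pre_jordan_identity1:
      "mult (anticomm mult x y) (mult z u) + mult (anticomm mult y z) (mult x u)
         + mult (anticomm mult z x) (mult y u)
       = mult x (mult y (mult z u)) + mult z (mult y (mult x u))
         + mult (anticomm mult (anticomm mult x z) y) u"
    and pre_jordan_identity2:
      "mult x (mult y (mult z u)) + mult z (mult y (mult x u))
         + mult (anticomm mult (anticomm mult x z) y) u
       = mult z (mult (anticomm mult x y) u) + mult x (mult (anticomm mult y z) u)
         + mult y (mult (anticomm mult z x) u)"

definition compatible_pre_jordan ::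
    "(complex \<Rightarrow> 'a::ab_group_add \<Rightarrow> 'a) \<Rightarrow> ('a \<Rightarrow> 'a \<Rightarrow> 'a) \<Rightarrow> ('a \<Rightarrow> 'a \<Rightarrow> 'a) \<Rightarrow> bool"
  where "compatible_pre_jordan s circ m \<longleftrightarrow>
    jordan_algebra s circ \<and> pre_jordan_algebra s m \<and> (\<forall>x y. anticomm m x y = circ x y)"

definition algebra_isomorphic ::
    "(complex \<Rightarrow> 'a::ab_group_add \<Rightarrow> 'a) \<Rightarrow> ('a \<Rightarrow> 'a \<Rightarrow> 'a) \<Rightarrow>
     (complex \<Rightarrow> 'b::ab_group_add \<Rightarrow> 'b) \<Rightarrow> ('b \<Rightarrow> 'b \<Rightarrow> 'b) \<Rightarrow> bool"
  where "algebra_isomorphic s m s' m' \<longleftrightarrow>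
    (\<exists>f. Vector_Spaces.linear s s' f \<and> bij f \<and> (\<forall>x y. f (m x y) = m' (f x) (f y)))"

(* The bilinear multiplication on complex^'n whose formal characteristic matrix with respect to
   the standard basis is M: the product of the i-th and j-th basis vectors is the vector M$i$j. *)
definition mult_of_matrix :: "(complex^'n)^'n^'n \<Rightarrow> complex^'n \<Rightarrow> complex^'n \<Rightarrow> complex^'n"
  where "mult_of_matrix M x y = (\<Sum>i\<in>UNIV. \<Sum>j\<in>UNIV. (x $ i * y $ j) *s (M $ i $ j))"

(* Type 3 is the integers modulo 3: the indices are 1, 2 and 3 = 0, and vector [a, b, c]
   has the components a, b, c at 1, 2, 3. *)
abbreviation e1 :: "complex^3" where "e1 \<equiv> axis 1 1"
abbreviation e2 :: "complex^3" where "e2 \<equiv> axis 2 1"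
abbreviation e3 :: "complex^3" where "e3 \<equiv> axis 3 1"

definition J1 :: "complex^3 \<Rightarrow> complex^3 \<Rightarrow> complex^3"
  where "J1 = mult_of_matrix (vector
    [vector [2 *s e1, 2 *s e2, 2 *s e3],
     vector [2 *s e2, 0,       2 *s e1],
     vector [2 *s e3, 2 *s e1, 0]])"

(* Meant for l \<noteq> 0 with l^2 - l + a = 0; statements using it carry these hypotheses. *)
definition J11 :: "complex \<Rightarrow> complex \<Rightarrow> complex^3 \<Rightarrow> complex^3 \<Rightarrow> complex^3"
  where "J11 a l = mult_of_matrix (vector
    [vector [e1,
             e1 + (1 + l) *s e2 + (1 / (2 * l)) *s e3,
             (2 * a) *s e1 + (2 * l * a) *s e2 + (2 - l) *s e3],
     vector [- e1 + (1 - l) *s e2 - (1 / (2 * l)) *s e3,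
             0,
             (2 * l) *s e1 - (2 * a) *s e2 + e3],
     vector [- (2 * a) *s e1 - (2 * l * a) *s e2 + l *s e3,
             (2 - 2 * l) *s e1 + (2 * a) *s e2 - e3,
             0]])"

definition J12 :: "complex^3 \<Rightarrow> complex^3 \<Rightarrow> complex^3"
  where "J12 = mult_of_matrix (vector
    [vector [e1, 2 *s e2, e3],
     vector [0,  0,       2 *s e1],
     vector [e3, 0,       0]])"

definition J13 :: "complex^3 \<Rightarrow> complex^3 \<Rightarrow> complex^3"
  where "J13 = mult_of_matrix (vector
    [vector [e1,        2 *s e2, e2 + e3],
     vector [0,         0,       2 *s e1],
     vector [- e2 + e3, 0,       0]])"

end

theory Submission
  imports Defs
begin

text \<open>
  Write \<open>L_x\<close> for left multiplication by \<open>x\<close>. A compatible multiplication is determined by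
  \<open>a = e2 \<cdot> e1\<close>, \<open>b = e3 \<cdot> e1\<close> and \<open>c = e2 \<cdot> e3\<close> (\<open>frame_mult\<close>), and the pre-Jordan identities say
  that \<open>L\<close> is a representation of \<open>J1\<close>. Since \<open>e1\<close> is twice the unit, \<open>L_e1\<close> commutes with every
  \<open>L_x\<close>, and it turns out to be diagonalizable with eigenvalues 1 and 2: the 1-eigenspace is a plane
  through \<open>e1\<close> on which \<open>L_e2\<close> and \<open>L_e3\<close> generate the Clifford algebra of the hyperbolic plane, and
  the 2-eigenspace is a line killed by both. The 1-eigenspace cannot have dimension 1 or 3, because
  that Clifford algebra is the algebra of 2 by 2 matrices, whose modules have even dimension.
  In coordinates these facts amount to the equations \<open>clifford_frame a b c\<close>. They are necessary
  (\<open>compatible_imp_clifford_frame\<close>) and sufficient (\<open>clifford_frame_compatible\<close>).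

  An isomorphism between compatible structures is an automorphism of \<open>J1\<close>. Such a map fixes \<open>e1\<close> and
  permutes the two isotropic lines \<open>\<complex> e2\<close> and \<open>\<complex> e3\<close> (\<open>J1_automorphism\<close>), so only the torus
  \<open>e2 \<mapsto> t e2\<close>, \<open>e3 \<mapsto> e3 / t\<close> and the swap of \<open>e2\<close> and \<open>e3\<close> are available. If \<open>a$1\<close> or \<open>b$1\<close> is
  nonzero, swap until \<open>a$1 \<noteq> 0\<close> and rescale until \<open>a$1 = -1\<close>: the equations leave exactly \<open>J11\<close> with
  \<open>l = b$3\<close>. If both vanish, then up to a swap all that survives is the coefficient \<open>b$2\<close>, which is 0 or
  can be rescaled to \<open>-1\<close>; these are \<open>J12\<close> and \<open>J13\<close>. The swap sends \<open>l\<close> to \<open>1 - l\<close>, so it exchanges the two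
  roots of \<open>x\<^sup>2 - x + \<alpha>\<close>, and comparing \<open>e2 \<cdot> e1\<close> and \<open>e3 \<cdot> e1\<close> under the two kinds of automorphism shows
  that nothing else is identified.
\<close>

section \<open>Multiplications whose anticommutator is the Jordan product\<close>

text \<open>Once the anticommutator is prescribed to be \<open>J1\<close>, the diagonal products \<open>e1 \<cdot> e1\<close>, \<open>e2 \<cdot> e2\<close>,
  \<open>e3 \<cdot> e3\<close> are fixed, and one product out of each pair \<open>x \<cdot> y\<close>, \<open>y \<cdot> x\<close> can be chosen freely.
  The chosen ones are \<open>a = e2 \<cdot> e1\<close>, \<open>b = e3 \<cdot> e1\<close> and \<open>c = e2 \<cdot> e3\<close>.\<close>

definition frame_mult :: "complex^3 \<Rightarrow> complex^3 \<Rightarrow> complex^3 \<Rightarrow> complex^3 \<Rightarrow> complex^3 \<Rightarrow> complex^3"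
  where "frame_mult a b c = mult_of_matrix (vector
    [vector [e1, 2 *s e2 - a, 2 *s e3 - b],
     vector [a,  0,           c],
     vector [b,  2 *s e1 - c, 0]])"

lemma axis_components [simp]:
  "e1 $ 1 = 1" "e1 $ 2 = 0" "e1 $ 3 = 0"
  "e2 $ 1 = 0" "e2 $ 2 = 1" "e2 $ 3 = 0"
  "e3 $ 1 = 0" "e3 $ 2 = 0" "e3 $ 3 = 1"
  by (simp_all add: axis_def)

lemma J1_component:
  "J1 x y $ 1 = 2 * x$1 * y$1 + 2 * x$2 * y$3 + 2 * x$3 * y$2"
  "J1 x y $ 2 = 2 * x$1 * y$2 + 2 * x$2 * y$1"
  "J1 x y $ 3 = 2 * x$1 * y$3 + 2 * x$3 * y$1"
  by (simp_all add: J1_def mult_of_matrix_def sum_3 algebra_simps)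

lemma frame_mult_component:
  "frame_mult a b c x y $ 1 = x$1 * y$1 + (x$2 * y$1 - x$1 * y$2) * a$1
     + (x$3 * y$1 - x$1 * y$3) * b$1 + (x$2 * y$3 - x$3 * y$2) * c$1 + 2 * x$3 * y$2"
  "frame_mult a b c x y $ 2 = 2 * x$1 * y$2 + (x$2 * y$1 - x$1 * y$2) * a$2
     + (x$3 * y$1 - x$1 * y$3) * b$2 + (x$2 * y$3 - x$3 * y$2) * c$2"
  "frame_mult a b c x y $ 3 = 2 * x$1 * y$3 + (x$2 * y$1 - x$1 * y$2) * a$3
     + (x$3 * y$1 - x$1 * y$3) * b$3 + (x$2 * y$3 - x$3 * y$2) * c$3"
  by (simp_all add: frame_mult_def mult_of_matrix_def sum_3 algebra_simps)

lemma complex_algebra_componentI: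
  fixes m :: "complex^3 \<Rightarrow> complex^3 \<Rightarrow> complex^3"
  assumes "\<And>x y z. m x (y + z) = m x y + m x z" "\<And>x y z. m (x + y) z = m x z + m y z"
    and "\<And>r x y. m x (r *s y) = r *s m x y" "\<And>r x y. m (r *s x) y = r *s m x y"
  shows "complex_algebra (*s) m"
  by unfold_locales (simp_all add: assms)

lemma complex_algebra_J1: "complex_algebra (*s) J1"
  by (rule complex_algebra_componentI) (simp_all add: vec_eq_iff forall_3 J1_component algebra_simps)

lemma complex_algebra_frame_mult: "complex_algebra (*s) (frame_mult a b c)"
  by (rule complex_algebra_componentI)
     (simp_all add: vec_eq_iff forall_3 frame_mult_component algebra_simps)

lemma J1_jordan: "jordan_algebra (*s) J1"
proof -
  interpret complex_algebra "(*s)" J1 by (rule complex_algebra_J1)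
  show ?thesis
  proof
    show "J1 x y = J1 y x" for x y
      by (simp add: vec_eq_iff forall_3 J1_component)
    show "J1 (J1 (J1 x x) y) x = J1 (J1 x x) (J1 y x)" for x y
      by (simp add: vec_eq_iff forall_3 J1_component) algebra
  qed
qed

lemma anticomm_frame_mult: "anticomm (frame_mult a b c) x y = J1 x y"
  by (simp add: anticomm_def vec_eq_iff forall_3 frame_mult_component J1_component algebra_simps)

lemma J11_frame: "l \<noteq> 0 \<Longrightarrow> J11 \<alpha> l = frame_mult (vector [-1, 1 - l, - 1 / (2 * l)])
    (vector [- 2 * \<alpha>, - 2 * l * \<alpha>, l]) (vector [2 * l, - 2 * \<alpha>, 1])"
  unfolding J11_def frame_mult_def
  by (intro arg_cong[where f = mult_of_matrix]) (simp add: vec_eq_iff forall_3)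

lemma J12_frame: "J12 = frame_mult 0 e3 (2 *s e1)"
  unfolding J12_def frame_mult_def
  by (intro arg_cong[where f = mult_of_matrix]) (simp add: vec_eq_iff forall_3)

lemma J13_frame: "J13 = frame_mult 0 (e3 - e2) (2 *s e1)"
  unfolding J13_def frame_mult_def
  by (intro arg_cong[where f = mult_of_matrix]) (simp add: vec_eq_iff forall_3)

lemma (in complex_algebra) mult_linear:
  "mult x (y + z) = mult x y + mult x z" "mult (x + y) z = mult x z + mult y z"
  "mult x (scale r y) = scale r (mult x y)" "mult (scale r x) y = scale r (mult x y)"
  using linear_right[of x] linear_left[of z] linear_left[of y]
  by (simp_all add: Vector_Spaces.linear_iff)

lemma compatible_eq_frame:
  assumes "compatible_pre_jordan (*s) J1 m"
  shows "m = frame_mult (m e2 e1) (m e3 e1) (m e2 e3)"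
proof -
  have pj: "pre_jordan_algebra (*s) m" and ac: "\<And>x y. anticomm m x y = J1 x y"
    using assms by (auto simp: compatible_pre_jordan_def)
  interpret pre_jordan_algebra "(*s)" m by (rule pj)
  have eqs: "m x y + m y x = J1 x y" for x y
    using ac[of x y] by (simp add: anticomm_def)
  have dia: "2 *s m e1 e1 = 2 *s e1" "2 *s m e2 e2 = 0" "2 *s m e3 e3 = 0"
    using eqs[of e1 e1] eqs[of e2 e2] eqs[of e3 e3]
    by (simp_all add: vec_eq_iff forall_3 J1_component)
  have tab: "m e1 e1 = e1" "m e2 e2 = 0" "m e3 e3 = 0"
     "m e1 e2 = 2 *s e2 - m e2 e1" "m e1 e3 = 2 *s e3 - m e3 e1" "m e3 e2 = 2 *s e1 - m e2 e3"
    using dia eqs[of e1 e2] eqs[of e1 e3] eqs[of e3 e2]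
    by (simp_all add: vec_eq_iff forall_3 J1_component algebra_simps)
  show ?thesis
  proof (intro ext)
    fix x y
    have dec: "v = (v$1) *s e1 + (v$2) *s e2 + (v$3) *s e3" for v :: "complex^3"
      by (simp add: vec_eq_iff forall_3)
    have "m x y = m ((x$1) *s e1 + (x$2) *s e2 + (x$3) *s e3) ((y$1) *s e1 + (y$2) *s e2 + (y$3) *s e3)"
      by (simp flip: dec)
    also have "\<dots> = frame_mult (m e2 e1) (m e3 e1) (m e2 e3) x y"
      by (simp add: mult_linear tab vec_eq_iff forall_3 frame_mult_component)
        (simp add: algebra_simps)
    finally show "m x y = frame_mult (m e2 e1) (m e3 e1) (m e2 e3) x y" .
  qed
qed

section \<open>Clifford frames are pre-Jordan\<close>

text \<open>On vectors \<open>v = x e2 + y e3\<close> write \<open>v \<cdot> e1 = r(v) e1 + C v\<close> with \<open>r(v) = a$1 x + b$1 y\<close>, so that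
  \<open>C\<close> is the matrix with columns \<open>(a$2, a$3)\<close> and \<open>(b$2, b$3)\<close>. The equations say that \<open>C\<close> has trace 1
  and determinant 0 (an idempotent of rank one), that \<open>2 r(v)\<^sup>2 e1\<close> is the Jordan square of \<open>v - C v\<close>
  (the three quadratic equations, by comparing coefficients of \<open>x\<^sup>2\<close>, \<open>x y\<close>, \<open>y\<^sup>2\<close>), that \<open>r\<close> vanishes
  on the image of \<open>C\<close>, and that \<open>c\<close> is determined by \<open>r\<close> and \<open>C\<close>.\<close>

definition clifford_frame :: "complex^3 \<Rightarrow> complex^3 \<Rightarrow> complex^3 \<Rightarrow> bool"
  where "clifford_frame a b c \<longleftrightarrow>
    c = vector [2 * b$3, b$1, - a$1] \<and> a$2 + b$3 = 1 \<and> a$2 * b$3 = a$3 * b$2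
    \<and> a$1 * a$1 = - 2 * a$3 * b$3 \<and> a$1 * b$1 = 2 * a$2 * b$3 \<and> b$1 * b$1 = - 2 * a$2 * b$2
    \<and> a$1 * a$2 + b$1 * a$3 = 0 \<and> a$1 * b$2 + b$1 * b$3 = 0"

lemma clifford_frameD:
  assumes "clifford_frame a b c"
  shows "c = vector [2 * b$3, b$1, - a$1]" "c$1 = 2 * b$3" "c$2 = b$1" "c$3 = - a$1"
    "a$2 = 1 - b$3" "a$2 + b$3 = 1" "a$2 * b$3 = a$3 * b$2"
    "a$1 * a$1 = - 2 * a$3 * b$3" "a$1 * b$1 = 2 * a$2 * b$3" "b$1 * b$1 = - 2 * a$2 * b$2"
    "a$1 * a$2 + b$1 * a$3 = 0" "a$1 * b$2 + b$1 * b$3 = 0"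
  using assms by (auto simp: clifford_frame_def algebra_simps)

text \<open>The structural reason for the pre-Jordan identities. With \<open>A = L_e1\<close>, the operator \<open>2 - A\<close> is the
  projection onto the 1-eigenspace of \<open>A\<close> along the 2-eigenspace; \<open>L_e2\<close> and \<open>L_e3\<close> live on the
  1-eigenspace and satisfy the Clifford relations there. These relations rewrite every word in the
  operators as a combination of \<open>u\<close>, \<open>A u\<close>, \<open>L_e2 u\<close>, \<open>L_e3 u\<close> and \<open>L_e2 (L_e3 u)\<close>; both identities
  then reduce to identities between polynomials in the coordinates of \<open>x\<close>, \<open>y\<close>, \<open>z\<close>.\<close>

lemma pre_jordan_from_clifford:
  fixes m :: "complex^3 \<Rightarrow> complex^3 \<Rightarrow> complex^3"
  assumes "complex_algebra (*s) m" and circ: "\<And>x y. anticomm m x y = J1 x y"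
    and unit: "\<And>u. m e1 (m e1 u) = 3 *s m e1 u - 2 *s u"
      "\<And>u. m e1 (m e2 u) = m e2 u" "\<And>u. m e2 (m e1 u) = m e2 u"
      "\<And>u. m e1 (m e3 u) = m e3 u" "\<And>u. m e3 (m e1 u) = m e3 u"
    and cliff: "\<And>u. m e2 (m e2 u) = 0" "\<And>u. m e3 (m e3 u) = 0"
      "\<And>u. m e3 (m e2 u) = 4 *s u - 2 *s m e1 u - m e2 (m e3 u)"
  shows "pre_jordan_algebra (*s) m"
proof -
  interpret complex_algebra "(*s)" m by fact
  have left: "m x u = (x$1) *s m e1 u + (x$2) *s m e2 u + (x$3) *s m e3 u" for x u
  proof -
    have "x = (x$1) *s e1 + (x$2) *s e2 + (x$3) *s e3"
      by (simp add: vec_eq_iff forall_3)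
    then have "m x u = m ((x$1) *s e1 + (x$2) *s e2 + (x$3) *s e3) u" by simp
    then show ?thesis by (simp only: mult_linear)
  qed
  have lin: "m e (v - w) = m e v - m e w" for e v w
    using linear_right[of e] by (simp add: Vector_Spaces.linear_iff vec.linear_diff linear_right)
  have zero: "m e 0 = 0" for e using lin[of e 0 0] by simp
  note red = mult_linear(1,3) lin zero unit cliff
  show ?thesis
  proof
    fix x y z u
    show "m (anticomm m x y) (m z u) + m (anticomm m y z) (m x u) + m (anticomm m z x) (m y u)
       = m x (m y (m z u)) + m z (m y (m x u)) + m (anticomm m (anticomm m x z) y) u"
      unfolding circ left[of x] left[of y] left[of z] left[of "J1 _ _"]
      by (simp only: red J1_component) (simp add: vec_eq_iff, algebra)
    show "m x (m y (m z u)) + m z (m y (m x u)) + m (anticomm m (anticomm m x z) y) u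
       = m z (m (anticomm m x y) u) + m x (m (anticomm m y z) u) + m y (m (anticomm m z x) u)"
      unfolding circ left[of x] left[of y] left[of z] left[of "J1 _ _"]
      by (simp only: red J1_component) (simp add: vec_eq_iff, algebra)
  qed
qed

text \<open>The converse of \<open>compatible_imp_clifford_frame\<close> below: in coordinates, the operator relations
  required by \<open>pre_jordan_from_clifford\<close> follow from the equations of \<open>clifford_frame\<close>.\<close>

lemma clifford_frame_compatible:
  assumes "clifford_frame a b c"
  shows "compatible_pre_jordan (*s) J1 (frame_mult a b c)"
proof -
  note r = assms[unfolded clifford_frame_def]
  have c: "c$1 = 2 * b$3" "c$2 = b$1" "c$3 = - a$1"
    using r by auto
  note r' = r[THEN conjunct2]
  have "pre_jordan_algebra (*s) (frame_mult a b c)"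
  proof (rule pre_jordan_from_clifford)
    fix u
    let ?m = "frame_mult a b c"
    show "?m e1 (?m e1 u) = 3 *s ?m e1 u - 2 *s u"
      using r' by (simp add: vec_eq_iff forall_3 frame_mult_component c, algebra)
    show "?m e1 (?m e2 u) = ?m e2 u"
      using r' by (simp add: vec_eq_iff forall_3 frame_mult_component c, algebra)
    show "?m e2 (?m e1 u) = ?m e2 u"
      using r' by (simp add: vec_eq_iff forall_3 frame_mult_component c, algebra)
    show "?m e1 (?m e3 u) = ?m e3 u"
      using r' by (simp add: vec_eq_iff forall_3 frame_mult_component c, algebra)
    show "?m e3 (?m e1 u) = ?m e3 u"
      using r' by (simp add: vec_eq_iff forall_3 frame_mult_component c, algebra)
    show "?m e2 (?m e2 u) = 0"
      using r' by (simp add: vec_eq_iff forall_3 frame_mult_component c, algebra)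
    show "?m e3 (?m e3 u) = 0"
      using r' by (simp add: vec_eq_iff forall_3 frame_mult_component c, algebra)
    show "?m e3 (?m e2 u) = 4 *s u - 2 *s ?m e1 u - ?m e2 (?m e3 u)"
      using r' by (simp add: vec_eq_iff forall_3 frame_mult_component c, algebra)
  qed (simp_all add: complex_algebra_frame_mult anticomm_frame_mult)
  then show ?thesis
    by (simp add: compatible_pre_jordan_def J1_jordan anticomm_frame_mult)
qed

section \<open>Compatible structures are Clifford frames\<close>

text \<open>All that the classification extracts from the pre-Jordan identities. The first statement is the
  equality of the outer sides for \<open>x = y = e1\<close>, using that \<open>e1\<close> is twice the unit. The second is the
  first identity for \<open>e1, e2, e3\<close>; it says \<open>(2 - A)(L_e2 L_e3 + L_e3 L_e2) = 2 A (2 - A)\<close> for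
  \<open>A = L_e1\<close>, that is, the Clifford relation on the 1-eigenspace of \<open>A\<close>.\<close>

lemma compatible_operator_identities:
  assumes "compatible_pre_jordan (*s) J1 m"
  shows "m e1 (m z u) = m z (m e1 u)"
    and "2 *s (m e2 (m e3 u) + m e3 (m e2 u)) - m e1 (m e2 (m e3 u) + m e3 (m e2 u))
      = 4 *s m e1 u - 2 *s m e1 (m e1 u)"
proof -
  have pj: "pre_jordan_algebra (*s) m" and ac: "\<And>x y. anticomm m x y = J1 x y"
    using assms by (auto simp: compatible_pre_jordan_def)
  interpret pre_jordan_algebra "(*s)" m by (rule pj)
  have J: "J1 e1 z = 2 *s z" "J1 z e1 = 2 *s z" "J1 e2 e3 = 2 *s e1" for z
    by (simp_all add: vec_eq_iff forall_3 J1_component)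
  have "m (J1 e1 e1) (m z u) + m (J1 e1 z) (m e1 u) + m (J1 z e1) (m e1 u)
      = m z (m (J1 e1 e1) u) + m e1 (m (J1 e1 z) u) + m e1 (m (J1 z e1) u)" for z u
    using pre_jordan_identity1[of e1 e1 z u] pre_jordan_identity2[of e1 e1 z u]
    unfolding ac by (rule trans)
  then have "m z (m e1 u) = m e1 (m z u)" for z u
    unfolding J mult_linear by (simp add: vec_eq_iff)
  then show comm: "m e1 (m z u) = m z (m e1 u)" for z u
    by (rule sym)
  have J4: "J1 (2 *s e3) e2 = 4 *s e1" by (simp add: vec_eq_iff forall_3 J1_component)
  have "m (J1 e1 e2) (m e3 u) + m (J1 e2 e3) (m e1 u) + m (J1 e3 e1) (m e2 u)
      = m e1 (m e2 (m e3 u)) + m e3 (m e2 (m e1 u)) + m (J1 (J1 e1 e3) e2) u"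
    using pre_jordan_identity1[of e1 e2 e3 u] unfolding ac .
  moreover have "m e3 (m e2 (m e1 u)) = m e1 (m e3 (m e2 u))"
    by (simp only: comm[of e2] comm[of e3])
  ultimately show "2 *s (m e2 (m e3 u) + m e3 (m e2 u)) - m e1 (m e2 (m e3 u) + m e3 (m e2 u))
      = 4 *s m e1 u - 2 *s m e1 (m e1 u)"
    unfolding J J4 mult_linear by (simp add: vec_eq_iff algebra_simps)
qed

text \<open>The hypotheses are the entries of \<open>C\<^sup>2 = C\<close> for the matrix \<open>C\<close> with rows \<open>(p, q)\<close>, \<open>(r, s)\<close>;
  the cases are the possible ranks.\<close>

lemma idempotent_2x2_cases:
  fixes p q r s :: complex
  assumes "p - p * p = r * q" "s - s * s = r * q" "r * (1 - p - s) = 0" "q * (1 - p - s) = 0"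
  obtains (zero) "p = 0" "q = 0" "r = 0" "s = 0"
    | (one) "p = 1" "q = 0" "r = 0" "s = 1"
    | (rank_one) "p + s = 1" "p * s = r * q"
proof (cases "p + s = 1")
  case True
  then have "p * s = r * q" using assms(1) by algebra
  then show ?thesis using True rank_one by blast
next
  case False
  then have "1 - p - s \<noteq> 0" by (auto simp: algebra_simps)
  then have z: "r = 0" "q = 0" using assms by auto
  then have "p * (1 - p) = 0" "s * (1 - s) = 0" using assms by (auto simp: algebra_simps)
  then have "p = 0 \<or> p = 1" "s = 0 \<or> s = 1" by auto
  then show ?thesis using False z zero one by auto
qed

text \<open>Applied to \<open>e1\<close>, the relations \<open>[L_e1, L_e2] = [L_e1, L_e3] = 0\<close> make the matrix \<open>C\<close> of
  \<open>clifford_frame\<close> an idempotent. Rank 0 and rank 2 are contradictory, and in rank 1 the commutation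
  relations on \<open>e2\<close> and \<open>e3\<close> together with the Clifford relation on \<open>e1\<close> give the remaining
  equations.\<close>

lemma compatible_imp_clifford_frame:
  assumes "compatible_pre_jordan (*s) J1 (frame_mult a b c)"
  shows "clifford_frame a b c"
proof -
  let ?m = "frame_mult a b c"
  note comm = compatible_operator_identities(1)[OF assms, THEN arg_cong[where f = "\<lambda>v. v $ _"]]
  note cliff = compatible_operator_identities(2)[OF assms, THEN arg_cong[where f = "\<lambda>v. v $ _"]]
  \<comment> \<open>The cancellation rules would turn polynomial equations into disjunctions.\<close>
  note [simp] = frame_mult_component and [simp del] = mult_cancel_left mult_cancel_right mult_eq_0_iff
  have e21: "a$1 * a$2 + b$1 * a$3 = 0"
    using comm[of e2 e1 1] by (simp, algebra?)
  have e22: "a$2 - a$2 * a$2 = a$3 * b$2"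
    using comm[of e2 e1 2] by (simp, algebra?)
  have e23: "a$3 * (1 - a$2 - b$3) = 0"
    using comm[of e2 e1 3] by (simp, algebra?)
  have e31: "a$1 * b$2 + b$1 * b$3 = 0"
    using comm[of e3 e1 1] by (simp, algebra?)
  have e32: "b$2 * (1 - a$2 - b$3) = 0"
    using comm[of e3 e1 2] by (simp, algebra?)
  have e33: "b$3 - b$3 * b$3 = a$3 * b$2"
    using comm[of e3 e1 3] by (simp, algebra?)
  have n21: "a$1 * a$1 + a$3 * c$1 = 0"
    using comm[of e2 e2 1] by (simp, algebra?)
  have n23: "a$3 * (a$1 + c$3) = 0"
    using comm[of e2 e2 3] by (simp, algebra?)
  have n31: "b$1 * b$1 + b$2 * (2 - c$1) = 0"
    using comm[of e3 e3 1] by (simp, algebra?)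
  have n32: "b$2 * (b$1 - c$2) = 0"
    using comm[of e3 e3 2] by (simp, algebra?)
  have c1: "c$1 * (b$3 - 1) = c$2 * a$1 + c$3 * b$1 - a$1 * b$1"
    using comm[of e2 e3 1] by (simp, algebra?)
  have c2: "c$2 * (b$3 - a$2) = c$3 * b$2 - b$1 * a$2"
    using comm[of e2 e3 2] by (simp, algebra?)
  have c3: "a$3 * (c$2 - b$1) = 0"
    using comm[of e2 e3 3] by (simp, algebra?)
  have d1: "(2 - c$1) * (a$2 - 1) = - c$2 * a$1 - c$3 * b$1 - a$1 * b$1"
    using comm[of e3 e2 1] by (simp, algebra?)
  have d2: "b$2 * (c$3 + a$1) = 0"
    using comm[of e3 e2 2] by (simp, algebra?)
  have d3: "c$3 * (b$3 - a$2) = - c$2 * a$3 - a$1 * b$3"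
    using comm[of e3 e2 3] by (simp, algebra?)
  from e22 e33 e23 e32 show ?thesis
  proof (cases rule: idempotent_2x2_cases)
    case zero
    \<comment> \<open>\<open>e2\<close> and \<open>e3\<close> span the 2-eigenspace of \<open>L_e1\<close>, and \<open>L_e2\<close>, \<open>L_e3\<close> preserve it; so neither
      \<open>e2 \<cdot> e3\<close> nor \<open>e3 \<cdot> e2\<close> has an \<open>e1\<close>-component, although they add up to \<open>2 e1\<close>.\<close>
    then have "a$1 = 0" "b$1 = 0" using n21 n31 by (simp_all add: mult_eq_0_iff)
    then have "c$1 = 0" "2 - c$1 = 0" using zero c1 d1 by (simp_all add: mult_eq_0_iff)
    then show ?thesis by simp
  next
    case one
    \<comment> \<open>\<open>L_e1\<close> is the identity, so the Clifford relation holds on a space of odd dimension.\<close>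
    then have "a$1 = 0" "b$1 = 0" using n21 n31 by (simp_all add: mult_eq_0_iff)
    note ab = this one
    have "c$3 * c$3 = 0" using ab cliff[of e2 3] by (simp, algebra?)
    moreover have "c$2 * c$3 + 2 = c$1" using ab cliff[of e3 3] by (simp, algebra?)
    moreover have "c$2 * c$3 + c$1 = 0" using ab cliff[of e2 2] by (simp, algebra?)
    ultimately show ?thesis by (simp add: mult_eq_0_iff)
  next
    case rank_one
    \<comment> \<open>The \<open>e1\<close>-component of the Clifford relation applied to \<open>e1\<close>.\<close>
    have key: "2 * a$1 * b$1 + c$1 * (b$3 - a$2) = 2 * b$3" if "c$2 = b$1" "c$3 = - a$1"
    proof -
      have "2 * a$1 * b$1 + c$1 * (b$3 - a$2) + 2 * a$2
          + (a$1 * a$2 + b$1 * a$3) * b$1 + (a$1 * b$2 + b$1 * b$3) * a$1 = 2"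
        using cliff[of e1 1] by (simp add: that algebra_simps)
      then have "2 * a$1 * b$1 + c$1 * (b$3 - a$2) + 2 * a$2 = 2" by (simp add: e21 e31)
      then have "2 * a$1 * b$1 + c$1 * (b$3 - a$2) = 2 - 2 * a$2" by (simp only: eq_diff_eq)
      also have "\<dots> = 2 * (a$2 + b$3) - 2 * a$2" by (simp only: rank_one(1) mult_1_right)
      finally show ?thesis by (simp add: distrib_left)
    qed
    have "c$2 = b$1 \<and> c$3 = - a$1 \<and> c$1 = 2 * b$3"
    proof (cases "a$3 = 0")
      case False
      then have c: "c$2 = b$1" "c$3 = - a$1" using c3 n23 by (auto simp: mult_eq_0_iff add_eq_0_iff)
      have "a$3 * (c$1 - 2 * b$3) = 0"
        using key[OF c] rank_one e21 n21 by algebra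
      then show ?thesis using False c by (simp add: mult_eq_0_iff)
    next
      case a3: True
      show ?thesis
      proof (cases "b$2 = 0")
        case False
        then have c: "c$2 = b$1" "c$3 = - a$1" using d2 n32 by (auto simp: mult_eq_0_iff add_eq_0_iff2)
        have "b$2 * (c$1 - 2 * b$3) = 0"
          using key[OF c] rank_one e31 n31 by algebra
        then show ?thesis using False c by (simp add: mult_eq_0_iff)
      next
        case b2: True
        \<comment> \<open>\<open>C\<close> is diagonal with distinct eigenvalues 0 and 1, and commutation alone fixes \<open>c\<close>.\<close>
        have "a$1 = 0" "b$1 = 0" using n21 n31 a3 b2 by (simp_all add: mult_eq_0_iff)
        moreover have "a$2 = 0 \<and> b$3 = 1 \<or> a$2 = 1 \<and> b$3 = 0" using rank_one a3 b2 by (auto simp: mult_eq_0_iff)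
        ultimately show ?thesis using c1 c2 d1 d3 a3 b2 by auto
      qed
    qed
    then have c: "c$1 = 2 * b$3" "c$2 = b$1" "c$3 = - a$1" by auto
    have a2: "a$2 = 1 - b$3" using rank_one(1) by (simp add: eq_diff_eq)
    have "a$1 * b$1 = 2 * a$2 * b$3"
      using key[OF c(2,3)] c(1) rank_one by algebra
    moreover have "b$1 * b$1 = - 2 * a$2 * b$2"
      using n31 unfolding c a2 by algebra
    moreover have "a$1 * a$1 = - 2 * a$3 * b$3"
      using n21 unfolding c by algebra
    ultimately show ?thesis
      unfolding clifford_frame_def using c rank_one e21 e31 by (simp add: vec_eq_iff forall_3)
  qed
qed

section \<open>Normal forms under isomorphism\<close>

lemma algebra_isomorphic_refl:
  fixes m :: "complex^3 \<Rightarrow> complex^3 \<Rightarrow> complex^3" shows "algebra_isomorphic (*s) m (*s) m"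
  unfolding algebra_isomorphic_def
  by (rule exI[of _ id]) (simp add: vec.linear_id)

lemma algebra_isomorphic_trans:
  assumes "algebra_isomorphic s m s' m'" "algebra_isomorphic s' m' s'' m''"
  shows "algebra_isomorphic s m s'' m''"
proof -
  obtain f g where "Vector_Spaces.linear s s' f" "bij f" "\<And>x y. f (m x y) = m' (f x) (f y)"
    "Vector_Spaces.linear s' s'' g" "bij g" "\<And>x y. g (m' x y) = m'' (g x) (g y)"
    using assms unfolding algebra_isomorphic_def by blast
  then show ?thesis
    unfolding algebra_isomorphic_def
    by (intro exI[of _ "g \<circ> f"]) (simp add: Vector_Spaces.linear_compose bij_comp)
qed

lemma linear_3I:
  fixes f :: "complex^3 \<Rightarrow> complex^3"
  assumes "\<And>x y. f (x + y) = f x + f y" "\<And>r x. f (r *s x) = r *s f x"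
  shows "Vector_Spaces.linear (*s) (*s) f"
  by unfold_locales (simp_all add: assms)

text \<open>Transport along the automorphism \<open>e2 \<mapsto> t e2\<close>, \<open>e3 \<mapsto> e3 / t\<close> of \<open>J1\<close>.\<close>

lemma frame_mult_rescale:
  assumes "t \<noteq> 0"
  shows "algebra_isomorphic (*s) (frame_mult a b c) (*s)
    (frame_mult (vector [a$1 / t, a$2, a$3 / t\<^sup>2]) (vector [t * b$1, t\<^sup>2 * b$2, b$3])
       (vector [c$1, t * c$2, c$3 / t]))"
proof -
  define f :: "complex^3 \<Rightarrow> complex^3" where "f x = vector [x$1, t * x$2, x$3 / t]" for x
  define g :: "complex^3 \<Rightarrow> complex^3" where "g x = vector [x$1, x$2 / t, t * x$3]" for x
  have "bij f"
    by (rule o_bij[of g]) (auto simp: fun_eq_iff f_def g_def vec_eq_iff forall_3 assms)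
  moreover have "Vector_Spaces.linear (*s) (*s) f"
    by (rule linear_3I) (simp_all add: f_def vec_eq_iff forall_3 algebra_simps add_divide_distrib)
  moreover have "f (frame_mult a b c x y) = frame_mult
      (vector [a$1 / t, a$2, a$3 / t\<^sup>2]) (vector [t * b$1, t\<^sup>2 * b$2, b$3])
      (vector [c$1, t * c$2, c$3 / t]) (f x) (f y)" for x y
    using assms by (simp add: f_def vec_eq_iff forall_3 frame_mult_component field_simps power2_eq_square)
  ultimately show ?thesis unfolding algebra_isomorphic_def by blast
qed

text \<open>Transport along the exchange of \<open>e2\<close> and \<open>e3\<close>. The new \<open>c\<close> is the image of the old \<open>e3 \<cdot> e2\<close>, that
  is, of \<open>2 e1 - c\<close>.\<close>

lemma frame_mult_swap:
  "algebra_isomorphic (*s) (frame_mult a b c) (*s)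
    (frame_mult (vector [b$1, b$3, b$2]) (vector [a$1, a$3, a$2]) (vector [2 - c$1, - c$3, - c$2]))"
proof -
  define f :: "complex^3 \<Rightarrow> complex^3" where "f x = vector [x$1, x$3, x$2]" for x
  have "bij f"
    by (rule o_bij[of f]) (auto simp: fun_eq_iff f_def vec_eq_iff forall_3)
  moreover have "Vector_Spaces.linear (*s) (*s) f"
    by (rule linear_3I) (simp_all add: f_def vec_eq_iff forall_3)
  moreover have "f (frame_mult a b c x y) = frame_mult (vector [b$1, b$3, b$2]) (vector [a$1, a$3, a$2])
      (vector [2 - c$1, - c$3, - c$2]) (f x) (f y)" for x y
    by (simp add: f_def vec_eq_iff forall_3 frame_mult_component algebra_simps)
  ultimately show ?thesis unfolding algebra_isomorphic_def by blast
qed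

lemma clifford_frame_swap:
  assumes "clifford_frame a b c"
  shows "clifford_frame (vector [b$1, b$3, b$2]) (vector [a$1, a$3, a$2])
    (vector [2 - c$1, - c$3, - c$2])"
proof -
  note r = clifford_frameD[OF assms]
  have "2 - 2 * b$3 = 2 * a$2" "b$3 + a$2 = 1" using r(5) by simp_all
  then show ?thesis
    using r(2-4,7-) by (simp add: clifford_frame_def vec_eq_iff forall_3 ac_simps)
qed

lemma J11_clifford_frame:
  assumes "l \<noteq> 0" "l\<^sup>2 - l + \<alpha> = 0"
  shows "clifford_frame (vector [-1, 1 - l, - 1 / (2 * l)])
    (vector [- 2 * \<alpha>, - 2 * l * \<alpha>, l]) (vector [2 * l, - 2 * \<alpha>, 1])"
proof -
  have \<alpha>: "\<alpha> = l - l * l" using assms(2) by algebra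
  show ?thesis
    unfolding \<alpha> using assms(1) by (simp add: clifford_frame_def vec_eq_iff forall_3 field_simps)
qed

text \<open>Rescaling by \<open>t = - a$1\<close> makes the \<open>e1\<close>-coefficient of \<open>e2 \<cdot> e1\<close> equal to \<open>-1\<close>. Because
  \<open>a$1 * a$1 = - 2 * a$3 * b$3\<close>, neither \<open>a$3\<close> nor \<open>b$3\<close> vanishes, and \<open>b$3\<close>, which the torus does not
  move, determines all other coefficients.\<close>

lemma frame_iso_J11:
  assumes "clifford_frame a b c" "a$1 \<noteq> 0"
  shows "b$3 \<noteq> 0" "algebra_isomorphic (*s) (frame_mult a b c) (*s) (J11 (b$3 - (b$3)\<^sup>2) (b$3))"
proof -
  note r = clifford_frameD[OF assms(1)]
  show l: "b$3 \<noteq> 0" using r assms(2) by auto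
  let ?l = "b$3" and ?t = "- a$1"
  have a3: "a$3 \<noteq> 0" using r assms(2) by auto
  have a2: "a$2 = 1 - ?l" using r by (simp add: algebra_simps)
  have "a$3 / ?t\<^sup>2 = - 1 / (2 * ?l)"
    using r a3 l assms(2) by (simp add: power2_eq_square)
  moreover have "?t * b$1 = - 2 * (?l - ?l\<^sup>2)"
    using r(9) unfolding a2 by algebra
  moreover have "?t\<^sup>2 * b$2 = - 2 * ?l * (?l - ?l\<^sup>2)"
    using r(7,8) unfolding a2 by algebra
  moreover have "a$1 / ?t = -1" "c$3 / ?t = 1" using r assms(2) by auto
  moreover have "c$1 = 2 * ?l" "c$2 = b$1" using r by auto
  ultimately show "algebra_isomorphic (*s) (frame_mult a b c) (*s) (J11 (?l - ?l\<^sup>2) ?l)"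
    using frame_mult_rescale[of ?t a b c] assms(2) a2 unfolding J11_frame[OF l] by simp
qed

text \<open>With \<open>a$1 = b$1 = 0\<close> and \<open>b$3 \<noteq> 0\<close> the equations force \<open>a = 0\<close> and \<open>b$3 = 1\<close>, leaving only
  \<open>b$2\<close>, on which the torus acts by \<open>t\<^sup>2\<close>.\<close>

lemma frame_iso_J12_J13:
  assumes "clifford_frame a b c" "a$1 = 0" "b$1 = 0" "b$3 \<noteq> 0"
  shows "algebra_isomorphic (*s) (frame_mult a b c) (*s) J12
    \<or> algebra_isomorphic (*s) (frame_mult a b c) (*s) J13"
proof -
  note r = clifford_frameD[OF assms(1)]
  have a: "a = 0" and b3: "b$3 = 1" and c: "c = 2 *s e1"
    using r assms by (auto simp: vec_eq_iff forall_3)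
  show ?thesis
  proof (cases "b$2 = 0")
    case True
    then have "b = e3" using b3 assms by (simp add: vec_eq_iff forall_3)
    then show ?thesis using a c algebra_isomorphic_refl by (simp add: J12_frame)
  next
    case False
    define t where "t = csqrt (- 1 / b$2)"
    have t: "t\<^sup>2 * b$2 = -1" using False by (simp add: t_def power2_csqrt)
    then have "t \<noteq> 0" by auto
    have "vector [a$1 / t, a$2, a$3 / t\<^sup>2] = (0 :: complex^3)"
       "vector [t * b$1, t\<^sup>2 * b$2, b$3] = e3 - e2" "vector [c$1, t * c$2, c$3 / t] = 2 *s e1"
      using a b3 c t assms by (simp_all add: vec_eq_iff forall_3)
    then show ?thesis using frame_mult_rescale[OF \<open>t \<noteq> 0\<close>, of a b c] by (simp add: J13_frame)
  qed
qed

text \<open>After a swap if necessary, one of the two preceding lemmas applies: if \<open>a$1\<close> and \<open>b$1\<close> both vanish,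
  the trace condition \<open>a$2 + b$3 = 1\<close> lets one of \<open>a$2\<close>, \<open>b$3\<close> be nonzero, and the swap exchanges
  them.\<close>

lemma clifford_frame_classification:
  assumes "clifford_frame a b c"
  shows "(\<exists>\<alpha> l. l \<noteq> 0 \<and> l\<^sup>2 - l + \<alpha> = 0 \<and> algebra_isomorphic (*s) (frame_mult a b c) (*s) (J11 \<alpha> l))
        \<or> algebra_isomorphic (*s) (frame_mult a b c) (*s) J12
        \<or> algebra_isomorphic (*s) (frame_mult a b c) (*s) J13" (is "?C (frame_mult a b c)")
proof -
  have direct: "?C (frame_mult a b c)" if "clifford_frame a b c" "a$1 \<noteq> 0 \<or> b$1 = 0 \<and> b$3 \<noteq> 0" for a b c
  proof (cases "a$1 = 0")
    case False
    have "(b$3)\<^sup>2 - b$3 + (b$3 - (b$3)\<^sup>2) = 0" by simp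
    then show ?thesis using frame_iso_J11[OF that(1) False] by blast
  next
    case True
    then show ?thesis using frame_iso_J12_J13[OF that(1)] that(2) by blast
  qed
  show ?thesis
  proof (cases "a$1 \<noteq> 0 \<or> b$1 = 0 \<and> b$3 \<noteq> 0")
    case True
    then show ?thesis using direct assms by blast
  next
    case False
    let ?a = "vector [b$1, b$3, b$2] :: complex^3" and ?b = "vector [a$1, a$3, a$2] :: complex^3"
      and ?c = "vector [2 - c$1, - c$3, - c$2] :: complex^3"
    have "a$2 + b$3 = 1" using assms by (simp add: clifford_frame_def)
    then have "?a$1 \<noteq> 0 \<or> ?b$1 = 0 \<and> ?b$3 \<noteq> 0" using False by auto
    then have "?C (frame_mult ?a ?b ?c)" using direct[OF clifford_frame_swap[OF assms]] by blast
    then show ?thesis using algebra_isomorphic_trans[OF frame_mult_swap] by blast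
  qed
qed

text \<open>The two roots are \<open>l\<close> and \<open>1 - l\<close> with product \<open>\<alpha>\<close>. If both are nonzero, then so is \<open>\<alpha>\<close>, hence the
  swapped frame has leading coefficient \<open>- 2 * \<alpha> \<noteq> 0\<close> and \<open>frame_iso_J11\<close> normalizes it, now with
  parameter \<open>1 - l\<close>.\<close>

lemma J11_same_parameter:
  assumes "l \<noteq> 0" "l\<^sup>2 - l + \<alpha> = 0" "\<mu> \<noteq> 0" "\<mu>\<^sup>2 - \<mu> + \<alpha> = 0"
  shows "algebra_isomorphic (*s) (J11 \<alpha> l) (*s) (J11 \<alpha> \<mu>)"
proof (cases "l = \<mu>")
  case True
  then show ?thesis by (simp add: algebra_isomorphic_refl)
next
  case False
  have "(l - \<mu>) * (l + \<mu> - 1) = 0" using assms(2,4) by algebra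
  with False have "l + \<mu> - 1 = 0" by simp
  then have mu: "\<mu> = 1 - l" by algebra
  have al: "\<alpha> = l * \<mu>" "\<alpha> = \<mu> - \<mu>\<^sup>2" using assms mu by algebra+
  note iso = frame_iso_J11(2)[OF clifford_frame_swap[OF J11_clifford_frame[OF assms(1,2)]]]
  show ?thesis
    unfolding J11_frame[OF assms(1)]
    by (rule algebra_isomorphic_trans[OF frame_mult_swap]) (use iso assms al mu in simp)
qed

section \<open>Separating the normal forms\<close>

text \<open>An automorphism fixes \<open>e1\<close>, being twice the unit, and preserves the elements of square zero.
  These form the union of the lines \<open>\<complex> e2\<close> and \<open>\<complex> e3\<close>; the scalars on the two lines are inverse
  to each other because \<open>e2 \<circ> e3 = 2 e1\<close>.\<close>

lemma J1_automorphism: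
  assumes lin: "Vector_Spaces.linear (*s) (*s) f" and "bij f"
    and hom: "\<And>x y. f (J1 x y) = J1 (f x) (f y)"
  obtains t where "t \<noteq> 0" "f e1 = e1" "f e2 = t *s e2" "f e3 = (1 / t) *s e3"
    | t where "t \<noteq> 0" "f e1 = e1" "f e2 = t *s e3" "f e3 = (1 / t) *s e2"
proof -
  have scale: "f (r *s x) = r *s f x" for r x using lin by (simp add: Vector_Spaces.linear_iff)
  have f0: "f 0 = 0" using scale[of 0 0] by simp
  obtain w where w: "f w = e1" using \<open>bij f\<close> by (metis bij_pointE)
  have "f (J1 w e1) = J1 e1 (f e1)" by (simp add: hom w)
  moreover have "J1 w e1 = 2 *s w" "J1 e1 (f e1) = 2 *s f e1"
    by (simp_all add: vec_eq_iff forall_3 J1_component)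
  ultimately have 1: "f e1 = e1" by (simp add: scale w vec_eq_iff)
  have null: "f e $ 1 = 0 \<and> f e $ 2 * f e $ 3 = 0" if "J1 e e = 0" for e
  proof -
    have "J1 (f e) (f e) = 0" using hom[of e e] that f0 by simp
    then show ?thesis by (auto simp: vec_eq_iff forall_3 J1_component)
  qed
  have n2: "f e2 $ 1 = 0 \<and> f e2 $ 2 * f e2 $ 3 = 0" and n3: "f e3 $ 1 = 0 \<and> f e3 $ 2 * f e3 $ 3 = 0"
    by (rule null, simp add: vec_eq_iff forall_3 J1_component)+
  have "J1 e2 e3 = 2 *s e1" by (simp add: vec_eq_iff forall_3 J1_component)
  then have "J1 (f e2) (f e3) = 2 *s e1" using hom[of e2 e3] by (simp add: scale 1)
  then have "J1 (f e2) (f e3) $ 1 = 2" by simp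
  then have "2 * (f e2 $ 2 * f e3 $ 3 + f e2 $ 3 * f e3 $ 2) = 2"
    using n2 by (simp add: J1_component algebra_simps)
  then have p: "f e2 $ 2 * f e3 $ 3 + f e2 $ 3 * f e3 $ 2 = 1"
    unfolding mult_cancel_left2 by simp
  show thesis
  proof (cases "f e2 $ 3 = 0")
    case True
    then have "f e2 $ 2 * f e3 $ 3 = 1" using p by simp
    moreover from this have "f e3 $ 2 = 0" using n3 by auto
    moreover have "f e2 $ 2 \<noteq> 0" using calculation by auto
    ultimately show thesis using that(1)[of "f e2 $ 2"] True n2 n3 1
      by (simp add: vec_eq_iff forall_3 field_simps)
  next
    case False
    then have z: "f e2 $ 2 = 0" using n2 by simp
    then have q: "f e2 $ 3 * f e3 $ 2 = 1" using p by simp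
    then have "f e3 $ 3 = 0" using n3 by auto
    then show thesis using that(2)[of "f e2 $ 3"] False z q n2 n3 1
      by (simp add: vec_eq_iff forall_3 field_simps)
  qed
qed

text \<open>Isomorphisms preserve the anticommutator \<open>J1\<close>, so comparing the images of \<open>e2 \<cdot> e1\<close> and \<open>e3 \<cdot> e1\<close>
  under the automorphisms of \<open>J1\<close> gives coordinate conditions on \<open>a\<close> and \<open>b\<close>, one set for the
  torus and one for the swap.\<close>

lemma frame_isomorphism_cases:
  assumes "algebra_isomorphic (*s) (frame_mult a b c) (*s) (frame_mult a' b' c')"
  obtains t where "t \<noteq> 0" "a$1 = t * a'$1" "t * a$2 = t * a'$2" "a$3 / t = t * a'$3"
      "t * b$1 = b'$1" "t\<^sup>2 * b$2 = b'$2" "b$3 = b'$3"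
    | t where "t \<noteq> 0" "a$1 = t * b'$1" "a$2 = b'$3" "a$3 = t\<^sup>2 * b'$2"
      "t * b$1 = a'$1" "t\<^sup>2 * b$2 = a'$3" "b$3 = a'$2"
proof -
  let ?m = "frame_mult a b c" and ?m' = "frame_mult a' b' c'"
  obtain f where lin: "Vector_Spaces.linear (*s) (*s) f" and "bij f"
    and hom: "\<And>x y. f (?m x y) = ?m' (f x) (f y)"
    using assms unfolding algebra_isomorphic_def by blast
  have add: "f (x + y) = f x + f y" and scale: "f (r *s x) = r *s f x" for r x y
    using lin by (simp_all add: Vector_Spaces.linear_iff)
  have homJ: "f (J1 x y) = J1 (f x) (f y)" for x y
    by (metis add hom anticomm_def anticomm_frame_mult)
  have m: "?m e2 e1 = a" "?m e3 e1 = b"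
    by (simp_all add: vec_eq_iff forall_3 frame_mult_component)
  have dec: "v = (v$1) *s e1 + (v$2) *s e2 + (v$3) *s e3" for v :: "complex^3"
      by (simp add: vec_eq_iff forall_3)
  have "f v = (v$1) *s f e1 + (v$2) *s f e2 + (v$3) *s f e3" for v
    by (subst (1) dec) (simp only: add scale)
  note expand = this
  have ab: "?m' (f e2) (f e1) = (a$1) *s f e1 + (a$2) *s f e2 + (a$3) *s f e3"
     "?m' (f e3) (f e1) = (b$1) *s f e1 + (b$2) *s f e2 + (b$3) *s f e3"
    using hom[of e2 e1] hom[of e3 e1] expand[of a] expand[of b] by (simp_all only: m)
  from lin \<open>bij f\<close> homJ show thesis
  proof (cases rule: J1_automorphism)
    case (1 t)
    show thesis using that(1)[OF 1(1)] 1(1) ab unfolding 1(2-4)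
      by (simp add: vec_eq_iff forall_3 frame_mult_component field_simps power2_eq_square)
  next
    case (2 t)
    show thesis using that(2)[OF 2(1)] 2(1) ab unfolding 2(2-4)
      by (simp add: vec_eq_iff forall_3 frame_mult_component field_simps power2_eq_square)
  qed
qed

text \<open>A torus element preserves \<open>b$3 = l\<close>, a swap turns it into \<open>a$2 = 1 - l\<close>; both leave
  \<open>l - l\<^sup>2 = \<alpha>\<close> unchanged.\<close>

lemma J11_parameter_unique:
  assumes "l \<noteq> 0" "l\<^sup>2 - l + \<alpha> = 0" "\<mu> \<noteq> 0" "\<mu>\<^sup>2 - \<mu> + \<beta> = 0"
    and "algebra_isomorphic (*s) (J11 \<alpha> l) (*s) (J11 \<beta> \<mu>)"
  shows "\<alpha> = \<beta>"
proof -
  have "l = \<mu> \<or> \<mu> = 1 - l"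
    using assms(5) unfolding J11_frame[OF assms(1)] J11_frame[OF assms(3)]
    by (rule frame_isomorphism_cases) auto
  moreover have "\<alpha> = l - l\<^sup>2" "\<beta> = \<mu> - \<mu>\<^sup>2"
    using assms(2,4) by (simp_all add: algebra_simps)
  ultimately show ?thesis by (auto simp: power2_diff)
qed

text \<open>In \<open>J11\<close> the product \<open>e2 \<cdot> e1\<close> has the \<open>e1\<close>-coefficient \<open>-1\<close>, whereas in \<open>J12\<close> and \<open>J13\<close> no product
  \<open>e2 \<cdot> e1\<close> or \<open>e3 \<cdot> e1\<close> has an \<open>e1\<close>-component.\<close>

lemma J11_not_iso_J12:
  assumes "l \<noteq> 0" shows "\<not> algebra_isomorphic (*s) (J11 \<alpha> l) (*s) J12"
proof
  assume "algebra_isomorphic (*s) (J11 \<alpha> l) (*s) J12"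
  then show False unfolding J11_frame[OF assms] J12_frame
    by (rule frame_isomorphism_cases) auto
qed

lemma J11_not_iso_J13:
  assumes "l \<noteq> 0" shows "\<not> algebra_isomorphic (*s) (J11 \<alpha> l) (*s) J13"
proof
  assume "algebra_isomorphic (*s) (J11 \<alpha> l) (*s) J13"
  then show False unfolding J11_frame[OF assms] J13_frame
    by (rule frame_isomorphism_cases) auto
qed

lemma J12_not_iso_J13: "\<not> algebra_isomorphic (*s) J12 (*s) J13"
proof
  assume "algebra_isomorphic (*s) J12 (*s) J13"
  then show False unfolding J12_frame J13_frame
    by (rule frame_isomorphism_cases) auto
qed

section \<open>The classification\<close>

lemma J11_compatible:
  "l \<noteq> 0 \<Longrightarrow> l\<^sup>2 - l + \<alpha> = 0 \<Longrightarrow> compatible_pre_jordan (*s) J1 (J11 \<alpha> l)"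
  using clifford_frame_compatible[OF J11_clifford_frame] by (simp add: J11_frame)

lemma J12_compatible: "compatible_pre_jordan (*s) J1 J12"
  unfolding J12_frame
  by (rule clifford_frame_compatible) (simp add: clifford_frame_def vec_eq_iff forall_3)

lemma J13_compatible: "compatible_pre_jordan (*s) J1 J13"
  unfolding J13_frame
  by (rule clifford_frame_compatible) (simp add: clifford_frame_def vec_eq_iff forall_3)

lemma compatible_classification:
  assumes "compatible_pre_jordan (*s) J1 m"
  shows "(\<exists>\<alpha> l. l \<noteq> 0 \<and> l\<^sup>2 - l + \<alpha> = 0 \<and> algebra_isomorphic (*s) m (*s) (J11 \<alpha> l))
        \<or> algebra_isomorphic (*s) m (*s) J12
        \<or> algebra_isomorphic (*s) m (*s) J13"
proof -
  note eq = compatible_eq_frame[OF assms]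
  have "compatible_pre_jordan (*s) J1 (frame_mult (m e2 e1) (m e3 e1) (m e2 e3))"
    using assms eq by simp
  from clifford_frame_classification[OF compatible_imp_clifford_frame[OF this]]
  show ?thesis unfolding eq[symmetric] .
qed

theorem proposition4p1:
  shows "jordan_algebra (*s) J1
    \<and> (\<forall>\<alpha> l. l \<noteq> 0 \<and> l\<^sup>2 - l + \<alpha> = 0 \<longrightarrow> compatible_pre_jordan (*s) J1 (J11 \<alpha> l))
    \<and> compatible_pre_jordan (*s) J1 J12
    \<and> compatible_pre_jordan (*s) J1 J13
    \<and> (\<forall>m. compatible_pre_jordan (*s) J1 m \<longrightarrow>
          (\<exists>\<alpha> l. l \<noteq> 0 \<and> l\<^sup>2 - l + \<alpha> = 0 \<and> algebra_isomorphic (*s) m (*s) (J11 \<alpha> l))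
        \<or> algebra_isomorphic (*s) m (*s) J12
        \<or> algebra_isomorphic (*s) m (*s) J13)
    \<and> (\<forall>\<alpha> l \<mu>. l \<noteq> 0 \<and> l\<^sup>2 - l + \<alpha> = 0 \<and> \<mu> \<noteq> 0 \<and> \<mu>\<^sup>2 - \<mu> + \<alpha> = 0 \<longrightarrow>
          algebra_isomorphic (*s) (J11 \<alpha> l) (*s) (J11 \<alpha> \<mu>))
    \<and> (\<forall>\<alpha> l \<beta> \<mu>. l \<noteq> 0 \<and> l\<^sup>2 - l + \<alpha> = 0 \<and> \<mu> \<noteq> 0 \<and> \<mu>\<^sup>2 - \<mu> + \<beta> = 0 \<and> \<alpha> \<noteq> \<beta> \<longrightarrow>
          \<not> algebra_isomorphic (*s) (J11 \<alpha> l) (*s) (J11 \<beta> \<mu>))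
    \<and> (\<forall>\<alpha> l. l \<noteq> 0 \<and> l\<^sup>2 - l + \<alpha> = 0 \<longrightarrow>
          \<not> algebra_isomorphic (*s) (J11 \<alpha> l) (*s) J12
        \<and> \<not> algebra_isomorphic (*s) (J11 \<alpha> l) (*s) J13)
    \<and> \<not> algebra_isomorphic (*s) J12 (*s) J13"
proof (intro conjI)
  show "jordan_algebra (*s) J1"
    by (rule J1_jordan)
  show "\<forall>\<alpha> l. l \<noteq> 0 \<and> l\<^sup>2 - l + \<alpha> = 0 \<longrightarrow> compatible_pre_jordan (*s) J1 (J11 \<alpha> l)"
    by (simp add: J11_compatible)
  show "compatible_pre_jordan (*s) J1 J12" "compatible_pre_jordan (*s) J1 J13"
    by (rule J12_compatible J13_compatible)+
  show "\<forall>m. compatible_pre_jordan (*s) J1 m \<longrightarrow>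
      (\<exists>\<alpha> l. l \<noteq> 0 \<and> l\<^sup>2 - l + \<alpha> = 0 \<and> algebra_isomorphic (*s) m (*s) (J11 \<alpha> l))
      \<or> algebra_isomorphic (*s) m (*s) J12 \<or> algebra_isomorphic (*s) m (*s) J13"
    by (intro allI impI) (rule compatible_classification)
  show "\<forall>\<alpha> l \<mu>. l \<noteq> 0 \<and> l\<^sup>2 - l + \<alpha> = 0 \<and> \<mu> \<noteq> 0 \<and> \<mu>\<^sup>2 - \<mu> + \<alpha> = 0 \<longrightarrow>
      algebra_isomorphic (*s) (J11 \<alpha> l) (*s) (J11 \<alpha> \<mu>)"
    by (intro allI impI) (elim conjE, rule J11_same_parameter)
  show "\<forall>\<alpha> l \<beta> \<mu>. l \<noteq> 0 \<and> l\<^sup>2 - l + \<alpha> = 0 \<and> \<mu> \<noteq> 0 \<and> \<mu>\<^sup>2 - \<mu> + \<beta> = 0 \<and> \<alpha> \<noteq> \<beta> \<longrightarrow>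
      \<not> algebra_isomorphic (*s) (J11 \<alpha> l) (*s) (J11 \<beta> \<mu>)"
    using J11_parameter_unique by metis
  show "\<forall>\<alpha> l. l \<noteq> 0 \<and> l\<^sup>2 - l + \<alpha> = 0 \<longrightarrow>
      \<not> algebra_isomorphic (*s) (J11 \<alpha> l) (*s) J12 \<and> \<not> algebra_isomorphic (*s) (J11 \<alpha> l) (*s) J13"
    by (simp add: J11_not_iso_J12 J11_not_iso_J13)
  show "\<not> algebra_isomorphic (*s) J12 (*s) J13"
    by (rule J12_not_iso_J13)
qed

end
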